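(* For every integer $N\geq1$ the set $\mathcal{S}_N$ is finite. Moreover $\mathcal{S}_1=\{1\}$, and for every $N\geq2$ every element of $\mathcal{S}_N$ is at most $4^N(N^2-1)$.
   Context: For $d\geq1$, $\mu_d$ denotes the set of complex $d$-th roots of unity. For an integer $N\geq1$, $\mathcal{S}_N$ is the set of integers $d\geq1$ for which there exists a function $f(z)=\sum_{j=1}^N a_jz^{b_j}$ on $\mathbb{C}^*$ with $|f(\zeta)|=1$ for all $\zeta\in\mu_d$, where: $b_1=0,b_2,\dots,b_N\in\mathbb{Z}$ are pairwise distinct integers such that $b_1,\dots,b_N$ and $d$ have no common positive factor other than $1$; and $a_1,\dots,a_N\in\mathbb{C}$ satisfy $\sum_{i\in I}a_i\neq0$ for every non-empty subset $I\subset\{1,\dots,N\}$. *)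

theory Defs
  imports Complex_Main
begin

definition roots_unity :: "nat \<Rightarrow> complex set" where
  "roots_unity d = {z. z ^ d = 1}"

text \<open>Integer exponents may be negative, so this is meant for nonzero arguments only.\<close>

definition laurent :: "nat \<Rightarrow> (nat \<Rightarrow> complex) \<Rightarrow> (nat \<Rightarrow> int) \<Rightarrow> complex \<Rightarrow> complex" where
  "laurent N a b z = (\<Sum>j=1..N. a j * z powi b j)"

definition S :: "nat \<Rightarrow> nat set" where
  "S N = {d. d \<ge> 1 \<and> (\<exists>(a :: nat \<Rightarrow> complex) (b :: nat \<Rightarrow> int).
      b 1 = 0 \<and>
      inj_on b {1..N} \<and>
      (\<forall>k::int. k > 0 \<and> k dvd int d \<and> (\<forall>j\<in>{1..N}. k dvd b j) \<longrightarrow> k = 1) \<and>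
      (\<forall>I. I \<subseteq> {1..N} \<and> I \<noteq> {} \<longrightarrow> (\<Sum>i\<in>I. a i) \<noteq> 0) \<and>
      (\<forall>\<zeta>\<in>roots_unity d. cmod (laurent N a b \<zeta>) = 1))}"

end

theory Submission
  imports Defs "HOL-Library.FuncSet"
begin

text \<open>
  Expanding \<open>\<bar>f\<bar>\<^sup>2 = 1\<close> on \<open>\<mu>\<^sub>d\<close>, the sum of \<open>a\<^sub>i cnj a\<^sub>j\<close> over all pairs with
  \<open>b\<^sub>i - b\<^sub>j \<equiv> k\<close> modulo \<open>d\<close> vanishes whenever \<open>k\<close> is not divisible by \<open>d\<close>. Suppose
  \<open>d > 4\<^sup>N\<^sup>-\<^sup>1\<close>. By Dirichlet's pigeonhole argument some \<open>0 < t < d\<close> gives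
  \<open>t b\<^sub>j \<equiv> x\<^sub>j\<close> modulo \<open>d\<close> with \<open>\<bar>x\<^sub>j\<bar> < d/4\<close>, so every congruence
  \<open>b\<^sub>i - b\<^sub>j \<equiv> b\<^sub>k - b\<^sub>l\<close> becomes an equality \<open>x\<^sub>i - x\<^sub>j = x\<^sub>k - x\<^sub>l\<close>. If \<open>x\<close> is not constant,
  the pairs (maximum of \<open>x\<close>, minimum of \<open>x\<close>) are a union of full residue classes of differences,
  so the product of the sum of \<open>a\<close> over the maximisers with the conjugate of the sum over the
  minimisers is \<open>0\<close>, contrary to the hypothesis on subset sums. Hence \<open>x = 0\<close> and \<open>d\<close> divides
  every \<open>t b\<^sub>j\<close>, which contradicts coprimality.
\<close>

section \<open>Discrete Fourier analysis on the roots of unity\<close>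

text \<open>This is a geometric series whose ratio \<open>q\<close> satisfies
  \<open>q ^ d = 1\<close>, so it vanishes unless \<open>q = 1\<close>, which happens exactly when
  \<open>d\<close> divides \<open>n\<close>.\<close>

lemma sum_cis_multiples:
  fixes n :: int
  assumes "d > 0"
  shows "(\<Sum>m<d. cis (2 * pi * real m * of_int n / real d)) = (if int d dvd n then of_nat d else 0)"
proof -
  define q where "q = cis (2 * pi * of_int n / real d)"
  have q: "cis (2 * pi * real m * of_int n / real d) = q ^ m" for m
    by (simp add: q_def DeMoivre mult_ac)
  have qd: "q ^ d = 1"
    using assms cis_multiple_2pi[of "of_int n"] by (simp add: q_def DeMoivre)
  have q1: "q = 1 \<longleftrightarrow> int d dvd n"
  proof
    assume "q = 1"
    then have "cos (2 * pi * of_int n / real d) = 1"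
      by (metis q_def cis.sel(1) one_complex.sel(1))
    then obtain k :: int where "2 * pi * of_int n / real d = of_int k * 2 * pi"
      using cos_one_2pi_int by blast
    then have "of_int n = (of_int (k * int d) :: real)"
      using assms by (simp add: field_simps)
    then show "int d dvd n"
      by (metis dvd_triv_right of_int_eq_iff)
  next
    assume "int d dvd n"
    then obtain k where "n = int d * k" ..
    then show "q = 1"
      using assms cis_multiple_2pi[of "of_int k"] by (simp add: q_def mult.assoc)
  qed
  show ?thesis
    unfolding q using q1 qd by (auto simp: geometric_sum)
qed

lemma laurent_cis:
  "laurent N a b (cis \<theta>) = (\<Sum>j=1..N. a j * cis (\<theta> * of_int (b j)))"
proof -
  have "cis \<theta> powi n = cis (\<theta> * of_int n)" for n
    by (cases n rule: int_cases2) (simp_all add: DeMoivre power_int_minus mult.commute)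
  then show ?thesis
    by (simp add: laurent_def)
qed

text \<open>Up to the factor \<open>d\<close>, both sides are the Fourier coefficient at frequency
  \<open>k\<close> of the squared modulus on the roots of unity. That function is constantly 1, so
  only frequencies divisible by \<open>d\<close> survive.\<close>

lemma sum_coeffs_residue_class:
  fixes k :: int
  assumes d: "d > 0"
    and unimodular: "\<And>z. z \<in> roots_unity d \<Longrightarrow> cmod (laurent N a b z) = 1"
    and k: "\<not> int d dvd k"
  shows "(\<Sum>(i,j) | i \<in> {1..N} \<and> j \<in> {1..N} \<and> int d dvd b i - b j - k. a i * cnj (a j)) = 0"
proof -
  define \<theta> where "\<theta> m = 2 * pi * real m / real d" for m :: nat
  let ?P = "{1..N} \<times> {1..N}"
  have norm1: "laurent N a b (cis (\<theta> m)) * cnj (laurent N a b (cis (\<theta> m))) = 1" for m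
  proof -
    have "cis (\<theta> m) ^ d = 1"
      using d cis_multiple_2pi[of "of_nat m"] by (simp add: DeMoivre \<theta>_def)
    then show ?thesis
      using unimodular[of "cis (\<theta> m)"] by (simp add: roots_unity_def complex_norm_square[symmetric])
  qed
  have expand: "laurent N a b (cis (\<theta> m)) * cnj (laurent N a b (cis (\<theta> m))) * cis (- \<theta> m * of_int k)
      = (\<Sum>(i,j)\<in>?P. a i * cnj (a j) * cis (2 * pi * real m * of_int (b i - b j - k) / real d))" for m
  proof -
    have "cis (\<theta> m * of_int (b i)) * cis (- (\<theta> m * of_int (b j))) * cis (- \<theta> m * of_int k)
        = cis (2 * pi * real m * of_int (b i - b j - k) / real d)" for i j
      by (simp add: cis_mult \<theta>_def algebra_simps diff_divide_distrib add_divide_distrib)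
    then have "a i * cis (\<theta> m * of_int (b i)) * cnj (a j * cis (\<theta> m * of_int (b j)))
          * cis (- \<theta> m * of_int k)
        = a i * cnj (a j) * cis (2 * pi * real m * of_int (b i - b j - k) / real d)" for i j
      by (simp only: complex_cnj_mult cis_cnj mult_ac)
    then show ?thesis
      unfolding laurent_cis cnj_sum sum_product sum.cartesian_product
      unfolding sum_distrib_right case_prod_unfold by (simp only:)
  qed
  \<comment> \<open>Each character value may be multiplied by the squared modulus, which is 1 by
    \<open>norm1\<close>; expanding and exchanging the sums then isolates the residue class of
    \<open>k\<close>.\<close>
  have "0 = (\<Sum>m<d. cis (- \<theta> m * of_int k))"
    using sum_cis_multiples[OF d, of "- k"] k by (simp add: \<theta>_def)
  also have "\<dots> = (\<Sum>m<d. \<Sum>(i,j)\<in>?P.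
      a i * cnj (a j) * cis (2 * pi * real m * of_int (b i - b j - k) / real d))"
    by (simp only: expand[symmetric] norm1 mult_1)
  also have "\<dots> = (\<Sum>(i,j)\<in>?P. a i * cnj (a j) *
      (\<Sum>m<d. cis (2 * pi * real m * of_int (b i - b j - k) / real d)))"
    by (subst sum.swap) (simp add: sum_distrib_left case_prod_unfold)
  also have "\<dots> = (\<Sum>(i,j)\<in>?P. if int d dvd b i - b j - k then a i * cnj (a j) * of_nat d else 0)"
    unfolding sum_cis_multiples[OF d] by (intro sum.cong) auto
  also have "\<dots> = (\<Sum>(i,j) | i \<in> {1..N} \<and> j \<in> {1..N} \<and> int d dvd b i - b j - k.
      a i * cnj (a j) * of_nat d)"
    by (intro sum.mono_neutral_cong_right) (auto split: if_splits)
  also have "\<dots> = (\<Sum>(i,j) | i \<in> {1..N} \<and> j \<in> {1..N} \<and> int d dvd b i - b j - k.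
      a i * cnj (a j)) * of_nat d"
    by (simp add: sum_distrib_right case_prod_unfold)
  finally show ?thesis
    using d by simp
qed

section \<open>Rigidity of integer models of the exponents\<close>

text \<open>The assumption on \<open>x\<close> makes it a Freiman homomorphism of order 2 from the
  residues of \<open>b\<close> modulo \<open>d\<close> to the integers. A nonconstant one would have
  a largest difference, attained only on \<open>F \<times> G\<close>, where the coefficient sum
  factors.\<close>

lemma difference_solution_constant:
  fixes x :: "nat \<Rightarrow> int"
  assumes d: "d > 0"
    and unimodular: "\<And>z. z \<in> roots_unity d \<Longrightarrow> cmod (laurent N a b z) = 1"
    and subset_sums: "\<And>I. I \<subseteq> {1..N} \<Longrightarrow> I \<noteq> {} \<Longrightarrow> (\<Sum>i\<in>I. a i) \<noteq> 0"
    and x: "\<And>i j k l. \<lbrakk>i \<in> {1..N}; j \<in> {1..N}; k \<in> {1..N}; l \<in> {1..N};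
        int d dvd (b i - b j) - (b k - b l)\<rbrakk> \<Longrightarrow> x i - x j = x k - x l"
    and pq: "p \<in> {1..N}" "q \<in> {1..N}"
  shows "x p = x q"
proof (rule ccontr)
  assume ne: "x p \<noteq> x q"
  define M where "M = Max (x ` {1..N})"
  define m where "m = Min (x ` {1..N})"
  define F where "F = {i\<in>{1..N}. x i = M}"
  define G where "G = {i\<in>{1..N}. x i = m}"
  have bounds: "m \<le> x i" "x i \<le> M" if "i \<in> {1..N}" for i
    using that by (auto simp: M_def m_def)
  have "m < M"
    using ne bounds[OF pq(1)] bounds[OF pq(2)] by linarith
  have "M \<in> x ` {1..N}" "m \<in> x ` {1..N}"
    using pq unfolding M_def m_def by (auto intro!: Max_in Min_in)
  then have "F \<noteq> {}" "G \<noteq> {}"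
    by (auto simp: F_def G_def)
  \<comment> \<open>The residue \<open>r\<close> splits \<open>F \<times> G\<close> into fibres,
    each of which turns out to be a whole residue class of differences over all index pairs.\<close>
  define r where "r = (\<lambda>(i, j). (b i - b j) mod int d)"
  have fibre: "(\<Sum>(i,j) | (i,j) \<in> F \<times> G \<and> r (i,j) = k. a i * cnj (a j)) = 0"
    if k: "k \<in> r ` (F \<times> G)" for k
  proof -
    obtain i0 j0 where ij: "i0 \<in> F" "j0 \<in> G" "k = r (i0, j0)"
      using k by blast
    have full: "i \<in> F \<and> j \<in> G"
      if "i \<in> {1..N}" "j \<in> {1..N}" "int d dvd b i - b j - (b i0 - b j0)" for i j
    proof -
      have "x i - x j = x i0 - x j0"
        using x[of i j i0 j0] that ij by (auto simp: F_def G_def)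
      then have "x i - x j = M - m"
        using ij by (simp add: F_def G_def)
      then show ?thesis
        using bounds[OF that(1)] bounds[OF that(2)] that by (auto simp: F_def G_def)
    qed
    \<comment> \<open>Comparison with the trivial pair \<open>(i0, i0)\<close> rules out frequency
      zero, the one frequency at which the coefficient need not vanish.\<close>
    have "\<not> int d dvd b i0 - b j0"
    proof
      assume "int d dvd b i0 - b j0"
      then have "x i0 - x j0 = x i0 - x i0"
        using x[of i0 j0 i0 i0] ij by (auto simp: F_def G_def)
      then show False
        using ij \<open>m < M\<close> by (simp add: F_def G_def)
    qed
    from sum_coeffs_residue_class[OF d unimodular this]
    have "(\<Sum>(i,j) | i \<in> {1..N} \<and> j \<in> {1..N} \<and> int d dvd b i - b j - (b i0 - b j0).
        a i * cnj (a j)) = 0" .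
    moreover have "{(i,j). i \<in> {1..N} \<and> j \<in> {1..N} \<and> int d dvd b i - b j - (b i0 - b j0)}
        = {(i,j). (i,j) \<in> F \<times> G \<and> r (i,j) = k}"
      using full by (auto simp: r_def ij mod_eq_dvd_iff F_def G_def)
    ultimately show ?thesis
      by simp
  qed
  have fin: "finite (F \<times> G)"
    by (simp add: F_def G_def)
  have "(\<Sum>i\<in>F. a i) * cnj (\<Sum>j\<in>G. a j) = (\<Sum>(i,j)\<in>F \<times> G. a i * cnj (a j))"
    by (simp add: sum_product sum.cartesian_product)
  also have "\<dots> = (\<Sum>k\<in>r ` (F \<times> G). \<Sum>(i,j) | (i,j) \<in> F \<times> G \<and> r (i,j) = k. a i * cnj (a j))"
    by (subst sum.image_gen[OF fin, of _ r]) (intro sum.cong, auto)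
  also have "\<dots> = 0"
    using fibre by (intro sum.neutral) blast
  finally have "(\<Sum>i\<in>F. a i) = 0 \<or> (\<Sum>j\<in>G. a j) = 0"
    by (metis complex_cnj_zero_iff mult_eq_0_iff)
  moreover have "F \<subseteq> {1..N}" "G \<subseteq> {1..N}"
    by (auto simp: F_def G_def)
  ultimately show False
    using \<open>F \<noteq> {}\<close> \<open>G \<noteq> {}\<close> subset_sums by blast
qed

section \<open>Simultaneous Diophantine approximation\<close>

lemma simultaneous_small_residues:
  fixes b :: "'a \<Rightarrow> int" and d r :: nat
  assumes "finite J" and r: "r > 0" and d: "d > r ^ card J"
  obtains t :: nat and x :: "'a \<Rightarrow> int"
  where "0 < t" "t < d" "\<And>j. j \<in> J \<Longrightarrow> int d dvd int t * b j - x j"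
    "\<And>j. j \<in> J \<Longrightarrow> int r * \<bar>x j\<bar> < int d"
proof -
  have d0: "int d > 0"
    using d by (cases d) auto
  define u where "u t j = (int t * b j) mod int d" for t :: nat and j
  \<comment> \<open>For each \<open>j\<close>, \<open>\<phi> t\<close> records which of the
    \<open>r\<close> intervals of length \<open>d / r\<close> contains the residue
    \<open>u t j\<close>. Restricting to \<open>J\<close> leaves only \<open>r ^ card J\<close>
    possible values.\<close>
  define \<phi> where "\<phi> t = (\<lambda>j\<in>J. (int r * u t j) div int d)" for t
  have "\<phi> ` {..<d} \<subseteq> J \<rightarrow>\<^sub>E {0..<int r}"
  proof (intro image_subsetI PiE_I)
    fix t j assume "j \<in> J"
    have "0 \<le> u t j" "u t j < int d"
      using d0 by (auto simp: u_def)
    then have "0 \<le> (int r * u t j) div int d" "int r * u t j < int r * int d"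
      using d0 r by (auto simp: pos_imp_zdiv_nonneg_iff)
    moreover from this have "(int r * u t j) div int d * int d < int r * int d"
      using div_mult_mod_eq[of "int r * u t j" "int d"] pos_mod_sign[OF d0, of "int r * u t j"]
      by linarith
    ultimately show "\<phi> t j \<in> {0..<int r}"
      using d0 \<open>j \<in> J\<close> by (simp add: \<phi>_def)
  qed (auto simp: \<phi>_def)
  then have "card (\<phi> ` {..<d}) \<le> card (J \<rightarrow>\<^sub>E {0..<int r})"
    using \<open>finite J\<close> by (intro card_mono finite_PiE) auto
  also have "\<dots> = r ^ card J"
    using \<open>finite J\<close> by (simp add: card_PiE)
  finally have "\<not> inj_on \<phi> {..<d}"
    using d by (intro pigeonhole) simp
  then obtain s t where st: "s < t" "t < d" "\<phi> s = \<phi> t"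
    unfolding inj_on_def by (metis lessThan_iff linorder_neqE_nat)
  show thesis
  proof (rule that[of "t - s" "\<lambda>j. u t j - u s j"])
    fix j assume j: "j \<in> J"
    have "int d dvd int n * b j - u n j" for n
      by (simp add: u_def)
    from dvd_diff[OF this[of t] this[of s]]
    show "int d dvd int (t - s) * b j - (u t j - u s j)"
      using st by (simp add: of_nat_diff algebra_simps)
    have "\<phi> s j = \<phi> t j"
      using st by simp
    then have "(int r * u s j) div int d = (int r * u t j) div int d"
      using j by (simp add: \<phi>_def)
    \<comment> \<open>Equal quotients cancel, so the difference of the scaled residues is a
      difference of two remainders modulo \<open>d\<close>.\<close>
    moreover have "int r * u n j = (int r * u n j) div int d * int d + (int r * u n j) mod int d" for n
      by simp
    ultimately have "int r * u t j - int r * u s j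
        = (int r * u t j) mod int d - (int r * u s j) mod int d"
      by (metis add_diff_cancel_left)
    moreover have "\<bar>p mod int d - q mod int d\<bar> < int d" for p q
      using pos_mod_bound[OF d0, of p] pos_mod_bound[OF d0, of q]
        pos_mod_sign[OF d0, of p] pos_mod_sign[OF d0, of q] by linarith
    ultimately have "\<bar>int r * (u t j - u s j)\<bar> < int d"
      by (simp only: right_diff_distrib)
    then show "int r * \<bar>u t j - u s j\<bar> < int d"
      by (simp add: abs_mult)
  qed (use st in auto)
qed

section \<open>The bound on \<open>d\<close> and its consequences\<close>

lemma S_le:
  assumes "N \<ge> 1" and "d \<in> S N"
  shows "d \<le> 4 ^ (N - 1)"
proof (rule ccontr)
  assume big: "\<not> d \<le> 4 ^ (N - 1)"
  obtain a b where d: "d \<ge> 1" and b1: "b 1 = 0"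
    and gcd1: "\<forall>k::int. k > 0 \<and> k dvd int d \<and> (\<forall>j\<in>{1..N}. k dvd b j) \<longrightarrow> k = 1"
    and subset_sums: "\<forall>I. I \<subseteq> {1..N} \<and> I \<noteq> {} \<longrightarrow> (\<Sum>i\<in>I. a i) \<noteq> 0"
    and unimodular: "\<forall>\<zeta>\<in>roots_unity d. cmod (laurent N a b \<zeta>) = 1"
    using assms(2) unfolding S_def mem_Collect_eq by blast
  \<comment> \<open>The factor 4 is chosen because four errors below \<open>d / 4\<close> add up to
    less than \<open>d\<close>. Index 1 is left out since \<open>b 1 = 0\<close> is matched exactly
    by 0; this gives the exponent \<open>N - 1\<close>.\<close>
  obtain t x where t: "0 < t" "t < d"
    and x: "\<And>j. j \<in> {2..N} \<Longrightarrow> int d dvd int t * b j - x j"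
      "\<And>j. j \<in> {2..N} \<Longrightarrow> int 4 * \<bar>x j\<bar> < int d"
    using simultaneous_small_residues[of "{2..N}" 4 d b] big by auto
  define y where "y j = (if j = 1 then 0 else x j)" for j
  have y: "int d dvd int t * b j - y j" "4 * \<bar>y j\<bar> < int d" if "j \<in> {1..N}" for j
    using that x[of j] b1 d by (auto simp: y_def)
  have differences: "y i - y j = y k - y l"
    if ijkl: "i \<in> {1..N}" "j \<in> {1..N}" "k \<in> {1..N}" "l \<in> {1..N}"
      and dvd: "int d dvd (b i - b j) - (b k - b l)" for i j k l
  proof -
    have "int d dvd int t * ((b i - b j) - (b k - b l))
        - ((int t * b i - y i) - (int t * b j - y j)
            - ((int t * b k - y k) - (int t * b l - y l)))"
      by (intro dvd_diff[OF dvd_mult[OF dvd]] dvd_diff[OF dvd_diff dvd_diff] y(1) ijkl)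
    also have "\<dots> = (y i - y j) - (y k - y l)"
      by (simp add: algebra_simps)
    finally have "int d dvd (y i - y j) - (y k - y l)" .
    moreover have "\<bar>(y i - y j) - (y k - y l)\<bar> < int d"
      using y(2)[OF ijkl(1)] y(2)[OF ijkl(2)] y(2)[OF ijkl(3)] y(2)[OF ijkl(4)] by linarith
    ultimately show ?thesis
      using dvd_imp_le_int[of "(y i - y j) - (y k - y l)" "int d"] by force
  qed
  have "y j = y 1" if "j \<in> {1..N}" for j
  proof (rule difference_solution_constant)
    show "y i - y j = y k - y l" if "i \<in> {1..N}" "j \<in> {1..N}" "k \<in> {1..N}" "l \<in> {1..N}"
      "int d dvd (b i - b j) - (b k - b l)" for i j k l
      using that by (rule differences)
  qed (use d unimodular subset_sums that assms(1) in auto)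
  then have dvd: "int d dvd int t * b j" if "j \<in> {1..N}" for j
    using y(1)[OF that] that by (simp add: y_def split: if_splits)
  \<comment> \<open>Cancelling \<open>e\<close> makes \<open>d div e\<close> a common divisor of
    \<open>d\<close> and all \<open>b j\<close>, hence 1. Then \<open>d\<close> divides
    \<open>t\<close>, against \<open>0 < t < d\<close>.\<close>
  define e where "e = gcd (int t) (int d)"
  have e: "e > 0" "e dvd int t" "e dvd int d"
    using t by (auto simp: e_def)
  have cop: "coprime (int d div e) (int t div e)"
    unfolding e_def using t by (metis coprime_commute div_gcd_coprime less_irrefl of_nat_0_eq_iff)
  have "int d div e dvd b j" if "j \<in> {1..N}" for j
  proof -
    have "(int d div e) * e dvd (int t div e * e) * b j"
      using dvd[OF that] e by simp
    then have "(int d div e) * e dvd (int t div e * b j) * e"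
      by (simp only: mult_ac)
    then have "int d div e dvd int t div e * b j"
      using e(1) unfolding dvd_mult_cancel_right by simp
    then show ?thesis
      using cop coprime_dvd_mult_right_iff by blast
  qed
  moreover have "int d div e > 0"
    using e d by (simp add: pos_imp_zdiv_pos_iff zdvd_imp_le)
  ultimately have "int d div e = 1"
    using e by (intro gcd1[rule_format]) (auto simp: div_dvd_iff_mult)
  then have "e = int d"
    using e by (metis dvd_mult_div_cancel mult.right_neutral)
  then show False
    using e t by (auto dest: zdvd_imp_le)
qed

lemma S_1: "S 1 = {1}"
proof
  show "S 1 \<subseteq> {1}"
  proof
    fix d assume d: "d \<in> S 1"
    then have "d \<ge> 1" by (simp add: S_def)
    then show "d \<in> {1}" using S_le[OF _ d] by simp
  qed
  show "{1} \<subseteq> S 1"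
    unfolding S_def
    \<comment> \<open>The witness is the constant function 1.\<close>
    by (auto intro!: exI[of _ "\<lambda>_. 1 :: complex"] exI[of _ "\<lambda>_. 0 :: int"]
        simp: laurent_def subset_singleton_iff)
qed

theorem theorem4p3:
  shows "(\<forall>N::nat. N \<ge> 1 \<longrightarrow> finite (S N)) \<and>
         S 1 = {1} \<and>
         (\<forall>N::nat. N \<ge> 2 \<longrightarrow> (\<forall>d\<in>S N. d \<le> 4 ^ N * (N ^ 2 - 1)))"
proof (intro conjI allI impI ballI)
  fix N :: nat assume "N \<ge> 1"
  then have "S N \<subseteq> {..4 ^ (N - 1)}"
    using S_le by blast
  then show "finite (S N)"
    using finite_subset by blast
next
  show "S 1 = {1}" by (rule S_1)
next
  fix N d :: nat assume N: "N \<ge> 2" and "d \<in> S N"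
  then have "d \<le> 4 ^ (N - 1)"
    by (intro S_le) auto
  also have "\<dots> \<le> 4 ^ N"
    by (intro power_increasing) auto
  \<comment> \<open>For \<open>N \<ge> 2\<close> the extra factor is at least 3.\<close>
  also have "\<dots> \<le> 4 ^ N * (N ^ 2 - 1)"
    using N power_mono[of 2 N 2] by simp
  finally show "d \<le> 4 ^ N * (N ^ 2 - 1)" .
qed

end
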